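(* Let $n=2m+1\ge 5$ be an odd integer. For $x\in\mathbb F_{2^n}$ let $D(x)$ be the $n\times n$ Dickson matrix $\mathcal D(a_0,a_1,\dots,a_{n-1})$ over $\mathbb F_{2^n}$ (with $q=2$) where $a_0=x^{2^m}+x^2$, $a_1=x^{2^m}+x$, $a_m=x^2+x$, and $a_i=0$ for all other $i$; let $D^*(x)$ denote the leading $(n-2)\times(n-2)$ principal submatrix of $D(x)$. Then the Welch function $W_n(X)=X^{2^m+3}$ on $\mathbb F_{2^n}$ is not 3rd order sum-free if and only if $\det D^*(x)=0$ for some $x\in\mathbb F_{2^n}\setminus\mathbb F_2$.
   Context: A function $f:\mathbb F_{2^n}\to\mathbb F_{2^n}$ is called 3rd order sum-free if for every $3$-dimensional $\mathbb F_2$-affine subspace $A$ of $\mathbb F_{2^n}$ one has $\sum_{a\in A}f(a)\neq 0$. For $a_0,\dots,a_{n-1}\in\mathbb F_{q^n}$, the Dickson matrix is $$\mathcal D(a_0,\dots,a_{n-1})=\begin{bmatrix}a_0&a_1&\cdots&a_{n-1}\\ a_{n-1}^q&a_0^q&\cdots&a_{n-2}^q\\ \vdots&\vdots&\ddots&\vdots\\ a_1^{q^{n-1}}&a_2^{q^{n-1}}&\cdots&a_0^{q^{n-1}}\end{bmatrix},$$ i.e. its $(i,j)$ entry ($0\le i,j\le n-1$) is $a_{(j-i)\bmod n}^{\,q^i}$. Here $q=2$. *)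

theory Defs
  imports
    "HOL-Library.Z2"
    "HOL-Library.Cardinality"
    "HOL-Number_Theory.Residues"
    "Jordan_Normal_Form.Determinant"
    "Jordan_Normal_Form.DL_Submatrix"
begin

(* The action of F_2 = bit on a ring; it is a vector space structure exactly when the ring
   has characteristic 2, see vector_space_bit_scale for the finite fields F_(2^n). *)
definition bit_scale :: "bit \<Rightarrow> 'a::ring_1 \<Rightarrow> 'a" where
  "bit_scale b x = of_bit b * x"

lemma vector_space_bit_scale:
  assumes card: "CARD('a::{field,finite}) = 2 ^ n"
  shows "vector_space (bit_scale :: bit \<Rightarrow> 'a \<Rightarrow> 'a)"
proof -
  have "CHAR('a) dvd 2 ^ n"
    using CHAR_dvd_CARD[where 'a = 'a] card by simp
  moreover have "prime CHAR('a)"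
    by (rule prime_CHAR_semidom) (simp add: finite_imp_CHAR_pos)
  ultimately have "CHAR('a) = 2"
    using prime_dvd_power primes_dvd_imp_eq two_is_prime_nat by blast
  then have "(2::'a) = 0"
    using of_nat_CHAR[where 'a = 'a] by simp
  then have "x + x = 0" for x :: 'a
    by (metis mult_2 mult_zero_left)
  then show ?thesis
    by unfold_locales (auto simp: bit_scale_def of_bool_def algebra_simps)
qed

definition F2_affine_subspace :: "nat \<Rightarrow> 'a::ring_1 set \<Rightarrow> bool" where
  "F2_affine_subspace k A \<longleftrightarrow>
     (\<exists>v W. Modules.module.subspace bit_scale W \<and> vector_space.dim bit_scale W = k \<and>
            A = (\<lambda>w. v + w) ` W)"

definition sum_free_of_order :: "nat \<Rightarrow> ('a::ring_1 \<Rightarrow> 'a) \<Rightarrow> bool" where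
  "sum_free_of_order k f \<longleftrightarrow> (\<forall>A. F2_affine_subspace k A \<longrightarrow> (\<Sum>a\<in>A. f a) \<noteq> 0)"

(* Entry (i, j) is a_((j - i) mod n) ^ (q ^ i); adding n keeps the natural subtraction exact. *)
definition dickson_mat :: "nat \<Rightarrow> nat \<Rightarrow> (nat \<Rightarrow> 'a::comm_ring_1) \<Rightarrow> 'a mat" where
  "dickson_mat q n a = mat n n (\<lambda>(i, j). a ((j + n - i) mod n) ^ (q ^ i))"

definition welch :: "nat \<Rightarrow> 'a::comm_ring_1 \<Rightarrow> 'a" where
  "welch m x = x ^ (2 ^ m + 3)"

(* The indices 0, 1, m are distinct only for m \<ge> 2. *)
definition welch_coeffs :: "nat \<Rightarrow> 'a::comm_ring_1 \<Rightarrow> nat \<Rightarrow> 'a" where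
  "welch_coeffs m x i =
     (if i = 0 then x ^ (2 ^ m) + x ^ 2
      else if i = 1 then x ^ (2 ^ m) + x
      else if i = m then x ^ 2 + x
      else 0)"

definition leading_principal_submatrix :: "nat \<Rightarrow> 'a mat \<Rightarrow> 'a mat" where
  "leading_principal_submatrix k M = submatrix M {..<k} {..<k}"

end

theory Submission
  imports Defs
begin

text \<open>
  As \<open>2 ^ m + 2 + 1\<close> has three binary digits, the sum of \<open>welch m\<close> over \<open>v + \<langle>a, b, c\<rangle>\<close> is
  the determinant with rows \<open>(u, u ^ 2, u ^ 2 ^ m)\<close>, \<open>u \<in> {a, b, c}\<close>. It is homogeneous, so one
  may take \<open>c = 1\<close>, \<open>b = x\<close>, \<open>a = y\<close>, and then it is the linearized polynomial \<open>L\<close> with the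
  coefficients of the Dickson matrix \<open>D\<close>, evaluated at \<open>y\<close>. So the question is whether \<open>L\<close>, which
  always has the roots \<open>0, 1, x, x + 1\<close>, has another one.

  Row \<open>i\<close> of \<open>D\<close> applied to \<open>(u ^ 2 ^ j)\<^sub>j\<close> gives \<open>L u ^ 2 ^ i\<close>. If \<open>y\<close> is another root, a
  combination of the three kernel vectors belonging to \<open>1, x, y\<close> has its last two coordinates zero,
  and the leading minor vanishes. Conversely, a row vector \<open>c\<close> annihilating the minor, padded by
  zeros, annihilates \<open>D\<close> because \<open>L\<close> vanishes at \<open>1\<close> and \<open>x\<close>. Hence the linearized polynomial of
  degree at most \<open>2 ^ (n - 3)\<close> with coefficients \<open>c\<close> vanishes on the image of \<open>L\<close>, which has therefore
  at most \<open>2 ^ (n - 3)\<close> elements, so that \<open>L\<close> has at least \<open>8\<close> roots.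
\<close>

section \<open>Characteristic two and the Frobenius map\<close>

lemma two_eq_0_if_CARD:
  assumes "CARD('a::{field,finite}) = 2 ^ n"
  shows "(2::'a) = 0"
proof -
  have "CHAR('a) dvd 2 ^ n"
    using CHAR_dvd_CARD[where 'a = 'a] assms by simp
  moreover have "prime CHAR('a)"
    by (rule prime_CHAR_semidom) (simp add: finite_imp_CHAR_pos)
  ultimately have "CHAR('a) = 2"
    using prime_dvd_power primes_dvd_imp_eq two_is_prime_nat by blast
  then show ?thesis
    using of_nat_CHAR[where 'a = 'a] by simp
qed

text \<open>Multiplication by a nonzero \<open>x\<close> permutes the nonzero elements; comparing
  their products gives \<open>x ^ (CARD('a) - 1) = 1\<close>.\<close>

lemma power_CARD_eq_same:
  fixes x :: "'a::{field,finite}"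
  shows "x ^ CARD('a) = x"
proof (cases "x = 0")
  case False
  have "bij_betw ((*) x) (- {0}) (- {0})"
    using False by (intro bij_betw_byWitness[where f' = "\<lambda>y. y / x"]) auto
  then have "(\<Prod>y\<in>- {0}. x * y) = \<Prod>(- {0})"
    by (rule prod.reindex_bij_betw)
  then have "x ^ card (- {0::'a}) = 1"
    by (simp add: prod.distrib)
  moreover have "CARD('a) = Suc (card (- {0::'a}))"
    by (metis Compl_eq_Diff_UNIV UNIV_I card.remove finite)
  ultimately show ?thesis by simp
qed (simp add: zero_power)

text \<open>As rewrite rules these reduce integer coefficients modulo 2, so that polynomial
  identities in characteristic 2 can be checked by expansion.\<close>

lemma numeral_char_2:
  assumes "(2::'a::comm_ring_1) = 0"
  shows "numeral (num.Bit0 k) = (0::'a)" "numeral (num.Bit1 k) = (1::'a)"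
proof -
  show even: "numeral (num.Bit0 k) = (0::'a)"
    using assms by (metis numeral_Bit0 mult_2 mult_zero_left)
  then show "numeral (num.Bit1 k) = (1::'a)"
    by (metis numeral_Bit0 numeral_Bit1 add_0)
qed

lemma add_self_char_2:
  assumes "(2::'a::comm_ring_1) = 0"
  shows "x + x = (0::'a)"
  using assms by (metis mult_2 mult_zero_left)

lemma diff_eq_add_char_2:
  assumes "(2::'a::comm_ring_1) = 0"
  shows "x - y = x + (y::'a)"
  using add_self_char_2[OF assms, of y] by (simp add: algebra_simps)

lemma add_eq_0_iff_char_2:
  assumes "(2::'a::comm_ring_1) = 0"
  shows "x + y = 0 \<longleftrightarrow> x = (y::'a)"
  by (simp add: eq_iff_diff_eq_0[of x y] diff_eq_add_char_2[OF assms])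

lemma add_power_two_power:
  assumes "(2::'a::comm_ring_1) = 0"
  shows "(x + y :: 'a) ^ (2 ^ k) = x ^ (2 ^ k) + y ^ (2 ^ k)"
proof (induction k)
  case (Suc k)
  have "(x + y) ^ (2 ^ Suc k) = ((x + y) ^ (2 ^ k))\<^sup>2"
    by (simp add: power_mult[symmetric] mult.commute)
  also have "\<dots> = (x ^ (2 ^ k))\<^sup>2 + (y ^ (2 ^ k))\<^sup>2"
    using assms by (simp add: Suc power2_sum)
  finally show ?case
    by (simp add: power_mult[symmetric] mult.commute)
qed simp

lemma sum_power_two_power:
  assumes "(2::'a::comm_ring_1) = 0"
  shows "(\<Sum>i\<in>A. f i :: 'a) ^ (2 ^ k) = (\<Sum>i\<in>A. f i ^ (2 ^ k))"
  by (induction A rule: infinite_finite_induct) (simp_all add: add_power_two_power[OF assms] zero_power)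

section \<open>Sums of the Welch function over affine 3-spaces\<close>

lemma mem_span_insert_bit_scale:
  assumes vs: "vector_space (bit_scale :: bit \<Rightarrow> 'a::field \<Rightarrow> 'a)" and two: "(2::'a) = 0"
  shows "x \<in> module.span bit_scale (insert a S) \<longleftrightarrow>
    x \<in> module.span bit_scale S \<or> x + (a::'a) \<in> module.span bit_scale S"
proof -
  interpret vector_space "bit_scale :: bit \<Rightarrow> 'a \<Rightarrow> 'a" by (fact vs)
  have "(\<exists>k. x - bit_scale k a \<in> span S) \<longleftrightarrow>
    x - bit_scale 0 a \<in> span S \<or> x - bit_scale 1 a \<in> span S"
    by (metis bit_not_one_iff)
  then show ?thesis
    unfolding span_breakdown_eq by (simp add: bit_scale_def diff_eq_add_char_2[OF two])
qed

text \<open>The larger span is the disjoint union of \<open>span S\<close> and its translate by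
  \<open>a\<close>. Three applications turn a sum over a 3-space into eight terms.\<close>

lemma sum_span_insert_bit_scale:
  fixes g :: "'a::{field,finite} \<Rightarrow> 'b::comm_monoid_add"
  assumes vs: "vector_space (bit_scale :: bit \<Rightarrow> 'a \<Rightarrow> 'a)" and two: "(2::'a) = 0"
    and a: "a \<notin> module.span bit_scale S"
  shows "(\<Sum>w\<in>module.span bit_scale (insert a S). g w) =
    (\<Sum>w\<in>module.span bit_scale S. g w + g (w + a))"
proof -
  interpret vector_space "bit_scale :: bit \<Rightarrow> 'a \<Rightarrow> 'a" by (fact vs)
  have "x \<in> (\<lambda>w. w + a) ` span S \<longleftrightarrow> x + a \<in> span S" for x
  proof
    assume "x + a \<in> span S"
    moreover have "x = x + a + a"
      by (simp add: add.assoc add_self_char_2[OF two])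
    ultimately show "x \<in> (\<lambda>w. w + a) ` span S" by blast
  qed (auto simp: add.assoc add_self_char_2[OF two])
  then have eq: "span (insert a S) = span S \<union> (\<lambda>w. w + a) ` span S"
    using mem_span_insert_bit_scale[OF vs two] by blast
  have "span S \<inter> (\<lambda>w. w + a) ` span S = {}"
    using a by (auto simp: span_add_eq)
  then have "(\<Sum>w\<in>span (insert a S). g w) =
      (\<Sum>w\<in>span S. g w) + (\<Sum>w\<in>(\<lambda>w. w + a) ` span S. g w)"
    unfolding eq by (intro sum.union_disjoint) auto
  also have "(\<Sum>w\<in>(\<lambda>w. w + a) ` span S. g w) = (\<Sum>w\<in>span S. g (w + a))"
    by (simp add: sum.reindex)
  finally show ?thesis
    by (simp add: sum.distrib)
qed

lemma sum_welch_affine3: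
  fixes v a b c :: "'a::{field,finite}"
  assumes vs: "vector_space (bit_scale :: bit \<Rightarrow> 'a \<Rightarrow> 'a)" and two: "(2::'a) = 0"
    and "c \<noteq> 0" "b \<notin> {0, c}" "a \<notin> {0, b, c, b + c}"
  shows "(\<Sum>w\<in>module.span bit_scale {a, b, c}. welch m (v + w)) =
    a * (b ^ 2 * c ^ 2 ^ m + b ^ 2 ^ m * c ^ 2) + a ^ 2 * (b * c ^ 2 ^ m + b ^ 2 ^ m * c) +
    a ^ 2 ^ m * (b * c ^ 2 + b ^ 2 * c)"
proof -
  interpret vector_space "bit_scale :: bit \<Rightarrow> 'a \<Rightarrow> 'a" by (fact vs)
  note mem = mem_span_insert_bit_scale[OF vs two]
  note eq0 = add_eq_0_iff_char_2[OF two]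
  have "a + b + c = 0 \<longleftrightarrow> a = b + c"
    using eq0[of a "b + c"] by (simp add: add.assoc)
  then have "c \<notin> span {}" "b \<notin> span {c}" "a \<notin> span {b, c}"
    using assms(3-) by (auto simp: mem eq0)
  then have "(\<Sum>w\<in>span {a, b, c}. welch m (v + w)) =
    welch m v + welch m (v + a) + (welch m (v + b) + welch m (v + (b + a))) +
    (welch m (v + c) + welch m (v + (c + a)) + (welch m (v + (c + b)) + welch m (v + (c + b + a))))"
    by (simp add: sum_span_insert_bit_scale[OF vs two] ac_simps)
  \<comment> \<open>This is a product of three additive maps: summed over the eight points, every
    term containing \<open>v\<close> cancels modulo 2.\<close>
  also have "welch m x = x ^ 2 ^ m * x ^ 2 * x" for x :: 'a
    by (simp add: welch_def power_add power3_eq_cube power2_eq_square)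
  ultimately show ?thesis
    by (simp add: add_power_two_power[OF two] add_power_two_power[OF two, where k=1, simplified])
       (simp add: algebra_simps numeral_char_2[OF two] power2_eq_square)
qed

lemma not_sum_free_3_welch_iff:
  assumes vs: "vector_space (bit_scale :: bit \<Rightarrow> 'a::{field,finite} \<Rightarrow> 'a)" and two: "(2::'a) = 0"
  shows "\<not> sum_free_of_order 3 (welch m :: 'a \<Rightarrow> 'a) \<longleftrightarrow>
    (\<exists>x y::'a. x \<notin> {0, 1} \<and> y \<notin> {0, 1, x, x + 1} \<and>
      (x ^ 2 ^ m + x ^ 2) * y + (x ^ 2 ^ m + x) * y ^ 2 + (x ^ 2 + x) * y ^ 2 ^ m = 0)"
    (is "?l \<longleftrightarrow> (\<exists>x y. ?R x y)")
proof -
  interpret vector_space "bit_scale :: bit \<Rightarrow> 'a \<Rightarrow> 'a" by (fact vs)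
  note mem = mem_span_insert_bit_scale[OF vs two]
  note eq0 = add_eq_0_iff_char_2[OF two]
  have eq0': "a + b + c = 0 \<longleftrightarrow> a = b + c" for a b c :: 'a
    using eq0[of a "b + c"] by (simp add: add.assoc)
  have sum: "(\<Sum>a\<in>(\<lambda>w. v + w) ` W. welch m a) = (\<Sum>w\<in>W. welch m (v + w))" for v :: 'a and W
    by (simp add: sum.reindex)
  show ?thesis
  proof
    assume ?l
    then obtain v W where W: "subspace W" "dim W = 3"
      and s0: "(\<Sum>w\<in>W. welch m (v + w)) = 0"
      unfolding sum_free_of_order_def F2_affine_subspace_def by (auto simp: sum)
    obtain B where B: "B \<subseteq> W" "independent B" "W \<subseteq> span B" "card B = 3"
      using basis_exists[of W] W by metis
    then obtain a b c where abc: "B = {a, b, c}" "a \<noteq> b" "a \<noteq> c" "b \<noteq> c"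
      by (auto simp: card_3_iff)
    have "span {a, b, c} = W"
      using B W abc span_subspace by blast
    moreover have ne: "c \<noteq> 0" "b \<notin> {0, c}" "a \<notin> {0, b, c, b + c}"
      using B(2) abc two by (auto simp: independent_insert mem eq0 eq0')
    ultimately have "a * (b ^ 2 * c ^ 2 ^ m + b ^ 2 ^ m * c ^ 2) +
        a ^ 2 * (b * c ^ 2 ^ m + b ^ 2 ^ m * c) + a ^ 2 ^ m * (b * c ^ 2 + b ^ 2 * c) = 0"
      using s0 sum_welch_affine3[OF vs two ne, of m v] by simp
    \<comment> \<open>The determinant is homogeneous of degree \<open>2 ^ m + 3\<close> in the basis
      vectors, so dividing them by \<open>c\<close> only splits off a nonzero factor.\<close>
    moreover have "a = (a / c) * c" "b = (b / c) * c"
      using ne by simp_all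
    then obtain x y where xy: "a = y * c" "b = x * c" by blast
    ultimately have "c * c ^ 2 * c ^ 2 ^ m *
        ((x ^ 2 ^ m + x ^ 2) * y + (x ^ 2 ^ m + x) * y ^ 2 + (x ^ 2 + x) * y ^ 2 ^ m) = 0"
      by (simp add: power_mult_distrib algebra_simps)
    then have "(x ^ 2 ^ m + x ^ 2) * y + (x ^ 2 ^ m + x) * y ^ 2 + (x ^ 2 + x) * y ^ 2 ^ m = 0"
      using \<open>c \<noteq> 0\<close> by simp
    then have "?R x y"
      using ne by (auto simp: xy distrib_right)
    then show "\<exists>x y. ?R x y" by blast
  next
    assume "\<exists>x y. ?R x y"
    then obtain x y where xy: "?R x y" by blast
    then have ne: "1 \<noteq> (0::'a)" "x \<notin> {0, 1}" "y \<notin> {0, x, 1, x + 1}" by auto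
    have "y + x = 1 \<longleftrightarrow> y = x + 1"
      using eq0'[of y x 1] eq0[of "y + x" 1] by simp
    with ne have "independent {y, x, 1}"
      by (auto simp: independent_insert mem eq0 eq0')
    then have "dim (span {y, x, 1}) = 3"
      using ne by (simp add: dim_eq_card_independent)
    \<comment> \<open>The sum does not depend on the translation, so the linear subspace itself
      serves as witness.\<close>
    then have "F2_affine_subspace 3 ((\<lambda>w. 0 + w) ` span {y, x, 1})"
      unfolding F2_affine_subspace_def by blast
    moreover have "(\<Sum>a\<in>(\<lambda>w. 0 + w) ` span {y, x, 1}. welch m a) = 0"
      unfolding sum sum_welch_affine3[OF vs two ne] using xy by (simp add: algebra_simps)
    ultimately show ?l
      unfolding sum_free_of_order_def by blast
  qed
qed

section \<open>Linearized polynomials and their roots\<close>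

definition linearized_poly :: "nat \<Rightarrow> (nat \<Rightarrow> 'a::comm_ring_1) \<Rightarrow> 'a \<Rightarrow> 'a" where
  "linearized_poly n a u = (\<Sum>k<n. a k * u ^ 2 ^ k)"

lemma linearized_poly_add:
  assumes "(2::'a::comm_ring_1) = 0"
  shows "linearized_poly n a (u + v :: 'a) = linearized_poly n a u + linearized_poly n a v"
  by (simp add: linearized_poly_def add_power_two_power[OF assms] distrib_left sum.distrib)

text \<open>The exponents \<open>2 ^ i\<close> are distinct, so no coefficients merge and a single
  nonzero \<open>c i\<close> makes the polynomial nonzero.\<close>

lemma card_linearized_poly_roots:
  fixes c :: "nat \<Rightarrow> 'a::field"
  assumes "i < Suc k" "c i \<noteq> 0"
  shows "card {u. linearized_poly (Suc k) c u = 0} \<le> 2 ^ k"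
proof -
  define p where "p = (\<Sum>i<Suc k. monom (c i) (2 ^ i))"
  have "coeff p (2 ^ i) = c i"
    using assms(1) by (simp only: p_def coeff_sum coeff_monom) (simp add: sum.delta')
  then have "p \<noteq> 0"
    using assms(2) by auto
  moreover have "degree p \<le> 2 ^ k"
    unfolding p_def
    by (intro degree_sum_le) (auto intro!: order.trans[OF degree_monom_le] power_increasing)
  moreover have "poly p u = linearized_poly (Suc k) c u" for u
    by (simp only: p_def poly_sum poly_monom linearized_poly_def)
  ultimately show ?thesis
    using card_poly_roots_bound[of p] by simp
qed

section \<open>Leading minors and kernel vectors\<close>

lemma pick_lessThan: "i < k \<Longrightarrow> pick {..<k} i = i"
proof -
  assume "i < k"
  then have "{a \<in> {..<k}. a < i} = {..<i}" by auto
  then show "pick {..<k} i = i"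
    using pick_card_in_set[of i "{..<k}"] \<open>i < k\<close> by simp
qed

lemma leading_principal_submatrix_mat:
  assumes "k \<le> n"
  shows "leading_principal_submatrix k (mat n n f) = mat k k f"
proof -
  have "{i. i < n \<and> i < k} = {..<k}"
    using assms by auto
  then show ?thesis
    unfolding leading_principal_submatrix_def submatrix_def
    using assms by (intro eq_matI) (auto simp: pick_lessThan)
qed

lemma det_mat_eq_0_iff:
  fixes f :: "nat \<times> nat \<Rightarrow> 'a::field"
  shows "det (mat k k f) = 0 \<longleftrightarrow>
    (\<exists>c. (\<exists>j<k. c j \<noteq> 0) \<and> (\<forall>i<k. (\<Sum>j<k. f (i, j) * c j) = 0))"
proof -
  have "det (mat k k f) = 0 \<longleftrightarrow>
      (\<exists>v. v \<in> carrier_vec k \<and> v \<noteq> 0\<^sub>v k \<and> mat k k f *\<^sub>v v = 0\<^sub>v k)"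
    by (rule det_0_iff_vec_prod_zero_field) simp
  also have "\<dots> \<longleftrightarrow> (\<exists>c. vec k c \<noteq> 0\<^sub>v k \<and> mat k k f *\<^sub>v vec k c = 0\<^sub>v k)"
    by (metis vec_carrier eq_vecI carrier_vecD dim_vec index_vec)
  also have "\<dots> \<longleftrightarrow> (\<exists>c. (\<exists>j<k. c j \<noteq> 0) \<and> (\<forall>i<k. (\<Sum>j<k. f (i, j) * c j) = 0))"
    by (intro ex_cong1 conj_cong)
      (auto simp: vec_eq_iff scalar_prod_def lessThan_atLeast0)
  finally show ?thesis .
qed

lemma det_mat_eq_0_iff_left:
  fixes f :: "nat \<times> nat \<Rightarrow> 'a::field"
  shows "det (mat k k f) = 0 \<longleftrightarrow>
    (\<exists>c. (\<exists>i<k. c i \<noteq> 0) \<and> (\<forall>j<k. (\<Sum>i<k. c i * f (i, j)) = 0))"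
proof -
  have "det (mat k k f) = det (mat k k (\<lambda>(i, j). f (j, i)))"
    by (subst det_transpose[symmetric, of _ k]) (auto intro!: arg_cong[of _ _ det])
  then show ?thesis
    by (simp add: det_mat_eq_0_iff mult.commute)
qed

section \<open>The Dickson matrix and the roots of its linearized polynomial\<close>

lemma dickson_row_eval:
  fixes u :: "'a::{field,finite}"
  assumes card: "CARD('a) = 2 ^ n" and i: "i < n"
  shows "(\<Sum>j<n. a ((j + n - i) mod n) ^ 2 ^ i * u ^ 2 ^ j) = linearized_poly n a u ^ 2 ^ i"
proof -
  note two = two_eq_0_if_CARD[OF card]
  have "(\<Sum>j<n. a ((j + n - i) mod n) ^ 2 ^ i * u ^ 2 ^ j) =
    (\<Sum>k<n. a k ^ 2 ^ i * u ^ 2 ^ (k + i))"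
  proof (rule sum.reindex_bij_witness[where i = "\<lambda>k. (k + i) mod n" and j = "\<lambda>j. (j + n - i) mod n"])
    fix j assume j: "j \<in> {..<n}"
    show "((j + n - i) mod n + i) mod n = j"
      using i j by (simp add: mod_simps)
    show "a ((j + n - i) mod n) ^ 2 ^ i * u ^ 2 ^ ((j + n - i) mod n + i) =
        a ((j + n - i) mod n) ^ 2 ^ i * u ^ 2 ^ j"
    proof (cases "i \<le> j")
      case True
      then have "(j + n - i) mod n = j - i"
        using i j by (simp add: mod_if)
      then show ?thesis using True by simp
    next
      \<comment> \<open>Here the index wraps around, which raises the exponent from
        \<open>2 ^ j\<close> to \<open>2 ^ (n + j)\<close>; \<open>u ^ 2 ^ n = u\<close> absorbs
        this.\<close>
      case False
      then have "(j + n - i) mod n + i = n + j"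
        using i j by simp
      moreover have "u ^ 2 ^ (n + j) = u ^ 2 ^ j"
        using power_CARD_eq_same[of u] by (simp add: power_add power_mult card)
      ultimately show ?thesis by simp
    qed
  next
    fix k assume k: "k \<in> {..<n}"
    have "(k + i) mod n + n - i = (if k + i < n then k + n else k)"
      using i k by (auto simp: mod_if)
    then show "((k + i) mod n + n - i) mod n = k"
      using k by simp
  qed (use i in auto)
  also have "\<dots> = linearized_poly n a u ^ 2 ^ i"
    by (simp add: linearized_poly_def sum_power_two_power[OF two] power_mult_distrib power_add
        mult.commute flip: power_mult)
  finally show ?thesis .
qed

lemma linearized_poly_welch_coeffs:
  assumes "m \<ge> 2" "n > m"
  shows "linearized_poly n (welch_coeffs m x) y =
    (x ^ 2 ^ m + x ^ 2) * y + (x ^ 2 ^ m + x) * y ^ 2 + (x ^ 2 + x) * y ^ 2 ^ m"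
proof -
  have "linearized_poly n (welch_coeffs m x) y =
      (\<Sum>k\<in>{0, 1, m}. welch_coeffs m x k * y ^ 2 ^ k)"
    unfolding linearized_poly_def using assms
    by (intro sum.mono_neutral_right) (auto simp: welch_coeffs_def)
  then show ?thesis
    using assms by (simp add: welch_coeffs_def add.assoc)
qed

text \<open>This is the Moore determinant of \<open>1, x, y\<close>; it factors as the product of
  the nonzero elements of their span over the prime field.\<close>

lemma moore_det3_neq_0:
  fixes x y :: "'a::field"
  assumes two: "(2::'a) = 0" and "x \<notin> {0, 1}" "y \<notin> {0, 1, x, x + 1}"
  shows "(x ^ 2 * y ^ 4 + x ^ 4 * y ^ 2) + (x * y ^ 4 + x ^ 4 * y) + (x * y ^ 2 + x ^ 2 * y) \<noteq> 0"
proof -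
  have "(x ^ 2 * y ^ 4 + x ^ 4 * y ^ 2) + (x * y ^ 4 + x ^ 4 * y) + (x * y ^ 2 + x ^ 2 * y) =
      x * (x + 1) * y * (y + 1) * (y + x) * (y + (x + 1))"
    by (simp add: algebra_simps numeral_char_2[OF two] power2_eq_square power4_eq_xxxx)
  then show ?thesis
    using assms by (auto simp: add_eq_0_iff_char_2[OF two])
qed

text \<open>By additivity the two given roots yield the roots \<open>0, 1, x, x + 1\<close>; the
  minor of order \<open>n - 2\<close> decides whether the kernel has dimension above two.\<close>

lemma det_dickson_eq_0_iff:
  fixes x :: "'a::{field,finite}"
  assumes card: "CARD('a) = 2 ^ n" and n: "n \<ge> 3" and x: "x \<notin> {0, 1}"
    and L1: "linearized_poly n a 1 = 0" and Lx: "linearized_poly n a x = 0"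
  shows "det (leading_principal_submatrix (n - 2) (dickson_mat 2 n a)) = 0 \<longleftrightarrow>
    (\<exists>y. y \<notin> {0, 1, x, x + 1} \<and> linearized_poly n a y = 0)"
proof -
  note two = two_eq_0_if_CARD[OF card]
  note eq0 = add_eq_0_iff_char_2[OF two]
  define d where "d i j = a ((j + n - i) mod n) ^ 2 ^ i" for i j
  have row: "(\<Sum>j<n. d i j * u ^ 2 ^ j) = linearized_poly n a u ^ 2 ^ i" if "i < n" for i u
    unfolding d_def by (rule dickson_row_eval[OF card that])
  \<comment> \<open>The minor has order \<open>r + 1\<close>, so a vector in its left kernel is the
    coefficient list of a linearized polynomial of degree at most \<open>2 ^ r\<close>.\<close>
  obtain r where r: "n = Suc (Suc (Suc r))"
    using n by (metis Suc_le_D numeral_3_eq_3 Suc_le_mono)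
  have M: "leading_principal_submatrix (n - 2) (dickson_mat 2 n a) =
      mat (Suc r) (Suc r) (\<lambda>(i, j). d i j)"
    using r by (simp add: dickson_mat_def leading_principal_submatrix_mat d_def del: add_Suc)
  have frob: "u ^ 2 ^ Suc (Suc (Suc r)) = u" for u :: 'a
    using power_CARD_eq_same[of u] by (simp add: card r)
  show ?thesis
  proof
    assume "\<exists>y. y \<notin> {0, 1, x, x + 1} \<and> linearized_poly n a y = 0"
    then obtain y where y: "y \<notin> {0, 1, x, x + 1}" and Ly: "linearized_poly n a y = 0" by blast
    define p q where "p = Suc r" and "q = Suc (Suc r)"
    \<comment> \<open>The combination of the vectors \<open>(u ^ 2 ^ j)\<^sub>j\<close>, \<open>u \<in> {1, x, y}\<close>, whose coordinates
      \<open>p\<close> and \<open>q\<close> vanish; its coordinate \<open>0\<close> is, up to a Frobenius power, a Moore determinant.\<close>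
    define \<alpha> \<beta> \<gamma> where "\<alpha> = x ^ 2 ^ p * y ^ 2 ^ q + x ^ 2 ^ q * y ^ 2 ^ p"
      and "\<beta> = y ^ 2 ^ p + y ^ 2 ^ q" and "\<gamma> = x ^ 2 ^ p + x ^ 2 ^ q"
    define c where "c j = \<alpha> * 1 ^ 2 ^ j + \<beta> * x ^ 2 ^ j + \<gamma> * y ^ 2 ^ j" for j
    \<comment> \<open>\<open>c j\<close> is the determinant with columns \<open>j, p, q\<close> and
      rows belonging to \<open>1, x, y\<close>; it has a repeated column for \<open>j = p\<close>
      and \<open>j = q\<close>.\<close>
    have c_last: "c p = 0" "c q = 0"
      by (simp_all add: c_def \<alpha>_def \<beta>_def \<gamma>_def algebra_simps numeral_char_2[OF two]
          mult_2_right[symmetric])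
    \<comment> \<open>As \<open>p = n - 2\<close> and \<open>q = n - 1\<close>, the fourth power
      carries the exponents \<open>2 ^ p\<close> and \<open>2 ^ q\<close> to \<open>1\<close> and
      \<open>2\<close>.\<close>
    have p4: "(u ^ 2 ^ p) ^ 4 = u" for u :: 'a
      using frob[of u] by (simp add: p_def flip: power_mult)
    have q4: "(u ^ 2 ^ q) ^ 4 = u ^ 2" for u :: 'a
      using arg_cong[OF p4[of u], of "\<lambda>t. t ^ 2"] by (simp add: p_def q_def flip: power_mult)
    have "c 0 ^ 4 = (x * y ^ 2 + x ^ 2 * y) + (y + y ^ 2) * x ^ 4 + (x + x ^ 2) * y ^ 4"
      unfolding c_def \<alpha>_def \<beta>_def \<gamma>_def
      using add_power_two_power[OF two, where k=2]
      by (simp add: power_mult_distrib p4 q4)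
    also have "\<dots> = (x ^ 2 * y ^ 4 + x ^ 4 * y ^ 2) + (x * y ^ 4 + x ^ 4 * y) + (x * y ^ 2 + x ^ 2 * y)"
      by (simp add: algebra_simps)
    finally have "c 0 \<noteq> 0"
      using moore_det3_neq_0[OF two x y] by auto
    moreover have "(\<Sum>j<Suc r. d i j * c j) = 0" if i: "i < Suc r" for i
    proof -
      have "i < n"
        using i r by simp
      have "(\<Sum>j<n. d i j * c j) = \<alpha> * (\<Sum>j<n. d i j * 1 ^ 2 ^ j) +
          \<beta> * (\<Sum>j<n. d i j * x ^ 2 ^ j) + \<gamma> * (\<Sum>j<n. d i j * y ^ 2 ^ j)"
        unfolding c_def by (simp add: algebra_simps sum.distrib sum_distrib_left)
      also have "\<dots> = 0"
        by (simp only: row[OF \<open>i < n\<close>] L1 Lx Ly) (simp add: zero_power)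
      finally show ?thesis
        using c_last by (simp add: r p_def q_def)
    qed
    ultimately show "det (leading_principal_submatrix (n - 2) (dickson_mat 2 n a)) = 0"
      unfolding M det_mat_eq_0_iff by (intro exI[of _ c]) auto
  next
    assume "det (leading_principal_submatrix (n - 2) (dickson_mat 2 n a)) = 0"
    then obtain c i0 where c: "i0 < Suc r" "c i0 \<noteq> 0"
      and cD: "\<And>j. j < Suc r \<Longrightarrow> (\<Sum>i<Suc r. c i * d i j) = 0"
      unfolding M det_mat_eq_0_iff_left by auto
    define s where "s j = (\<Sum>i<Suc r. c i * d i j)" for j
    \<comment> \<open>\<open>s\<close> is the product of the row vector \<open>c\<close>, padded by zeros, with the whole Dickson matrix;
      its first \<open>n - 2\<close> entries vanish, and evaluation at \<open>1\<close> and \<open>x\<close> kills the other two.\<close>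
    have compose: "linearized_poly (Suc r) c (linearized_poly n a u) =
        s (Suc r) * u ^ 2 ^ Suc r + s (Suc (Suc r)) * u ^ 2 ^ Suc (Suc r)" for u
    proof -
      have first: "(\<Sum>j<Suc r. s j * u ^ 2 ^ j) = 0"
        unfolding s_def by (rule sum.neutral) (use cD in simp)
      have "linearized_poly (Suc r) c (linearized_poly n a u) =
          (\<Sum>i<Suc r. c i * (\<Sum>j<n. d i j * u ^ 2 ^ j))"
        unfolding linearized_poly_def[of "Suc r"]
      proof (intro sum.cong refl)
        fix i assume "i \<in> {..<Suc r}"
        then have "i < n" by (simp add: r)
        then show "c i * linearized_poly n a u ^ 2 ^ i = c i * (\<Sum>j<n. d i j * u ^ 2 ^ j)"
          by (simp only: row)
      qed
      also have "\<dots> = (\<Sum>j<n. s j * u ^ 2 ^ j)"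
        unfolding s_def sum_distrib_left sum_distrib_right
        by (subst sum.swap) (simp only: mult.assoc)
      also have "\<dots> = s (Suc r) * u ^ 2 ^ Suc r + s (Suc (Suc r)) * u ^ 2 ^ Suc (Suc r)"
        by (simp only: r sum.lessThan_Suc[of _ "Suc (Suc r)"] sum.lessThan_Suc[of _ "Suc r"] first add_0)
      finally show ?thesis .
    qed
    have P0: "linearized_poly (Suc r) c 0 = 0"
      by (simp add: linearized_poly_def zero_power)
    define X where "X = x ^ 2 ^ Suc r"
    have Xq: "x ^ 2 ^ Suc (Suc r) = X ^ 2"
      by (simp add: X_def mult.commute flip: power_mult)
    have s1: "s (Suc r) = s (Suc (Suc r))"
      using compose[of 1] by (simp add: L1 P0 eq0)
    \<comment> \<open>This passes \<open>x \<notin> {0, 1}\<close> on to \<open>X\<close>, so that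
      \<open>X * (X + 1)\<close> can be cancelled below.\<close>
    have "X ^ 4 = x"
      using frob[of x] by (simp add: X_def mult.commute flip: power_mult)
    then have "X \<noteq> 0" "X \<noteq> 1" using x by auto
    moreover have "s (Suc r) * X * (X + 1) = 0"
      using compose[of x] by (simp add: Lx P0 Xq s1 X_def[symmetric] algebra_simps power2_eq_square
          del: power_Suc)
    ultimately have s0: "s (Suc r) = 0"
      by (simp add: eq0)
    have "range (linearized_poly n a) \<subseteq> {u. linearized_poly (Suc r) c u = 0}"
      using compose s0 s1 by auto
    then have im: "card (range (linearized_poly n a)) \<le> 2 ^ r"
      using card_linearized_poly_roots[of i0 r c, OF c] card_mono[OF finite] le_trans by metis
    show "\<exists>y. y \<notin> {0, 1, x, x + 1} \<and> linearized_poly n a y = 0"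
    proof (rule ccontr)
      assume no: "\<not> ?thesis"
      \<comment> \<open>Nonempty fibres are translates of the root set, which is assumed to have no
        element besides the four known ones.\<close>
      have fib: "card (linearized_poly n a -` {w}) \<le> 4" for w
      proof (cases "\<exists>u. linearized_poly n a u = w")
        case True
        then obtain u where u: "linearized_poly n a u = w" by blast
        have "linearized_poly n a -` {w} \<subseteq> (\<lambda>k. k + u) ` {0, 1, x, x + 1}"
        proof
          fix t assume "t \<in> linearized_poly n a -` {w}"
          then have "linearized_poly n a (t + u) = 0"
            using u by (simp add: linearized_poly_add[OF two] two)
          then have "t + u \<in> {0, 1, x, x + 1}"
            using no by blast
          moreover have "t = t + u + u"
            by (simp add: add.assoc add_self_char_2[OF two])
          ultimately show "t \<in> (\<lambda>k. k + u) ` {0, 1, x, x + 1}" by blast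
        qed
        then have "card (linearized_poly n a -` {w}) \<le> card ((\<lambda>k. k + u) ` {0, 1, x, x + 1})"
          by (intro card_mono) auto
        also have "\<dots> \<le> card {0, 1, x, x + 1}"
          by (rule card_image_le) simp
        also have "\<dots> \<le> 4"
          by (simp add: card_insert_if)
        finally show ?thesis .
      next
        case False
        then have "linearized_poly n a -` {w} = {}" by auto
        then show ?thesis by simp
      qed
      \<comment> \<open>Counting by fibres bounds the field size \<open>8 * 2 ^ r\<close> by
        \<open>4 * 2 ^ r\<close>.\<close>
      have "CARD('a) = card (\<Union>w\<in>range (linearized_poly n a). linearized_poly n a -` {w})"
        by (rule arg_cong[of _ _ card]) auto
      also have "\<dots> \<le> (\<Sum>w\<in>range (linearized_poly n a). card (linearized_poly n a -` {w}))"
        by (rule card_UN_le) simp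
      also have "\<dots> \<le> card (range (linearized_poly n a)) * 4"
        using sum_bounded_above[of "range (linearized_poly n a)", OF fib] by simp
      also have "\<dots> \<le> 2 ^ r * 4"
        using im by simp
      finally show False
        by (simp add: card r)
    qed
  qed
qed

theorem theorem5p8:
  fixes m n :: nat
  assumes "n = 2 * m + 1" and "n \<ge> 5"
    and "CARD('a::{field,finite}) = 2 ^ n"
  shows "\<not> sum_free_of_order 3 (welch m :: 'a \<Rightarrow> 'a) \<longleftrightarrow>
    (\<exists>x::'a. x \<notin> {0, 1} \<and>
       det (leading_principal_submatrix (n - 2) (dickson_mat 2 n (welch_coeffs m x))) = 0)"
proof -
  note card = assms(3)
  note two = two_eq_0_if_CARD[OF card]
  have m: "m \<ge> 2" "n > m" "n \<ge> 3"
    using assms(1,2) by auto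
  note L = linearized_poly_welch_coeffs[OF m(1,2)]
  \<comment> \<open>At \<open>y = 1\<close> and at \<open>y = x\<close> the determinant with rows
    belonging to \<open>y, x, 1\<close> has a repeated row.\<close>
  have "linearized_poly n (welch_coeffs m x) 1 = 0" for x :: 'a
    unfolding L by (simp add: algebra_simps numeral_char_2[OF two] flip: mult_2)
  moreover have "linearized_poly n (welch_coeffs m x) x = 0" for x :: 'a
    unfolding L by (simp add: algebra_simps numeral_char_2[OF two] flip: mult_2)
  ultimately show ?thesis
    unfolding not_sum_free_3_welch_iff[OF vector_space_bit_scale[OF card] two]
    using det_dickson_eq_0_iff[OF card m(3)] by (metis L)
qed

end
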